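(* Let $0 < k \leq m \leq \infty$ ($k$ an integer, $m$ an integer or $\infty$) and let $0 < \theta \leq 1$. The negative occupancy distribution can be written as a weighted sum of geometric distributions: for every integer $t \geq 0$, $$\text{NegOcc}(t|m,k,\theta) = \sum_{i=1}^{k} w_{i,k} \cdot \text{Geom}\left(t+k-1 \,\middle|\, \theta\cdot\frac{m-i+1}{m}\right),$$ using the weights $$w_{i,k} = (-1)^{k-i}\, \frac{(m)_k}{(m-i+1)\,(i-1)!\,(k-i)!}.$$
   Context: Falling factorials: $(m)_k = \prod_{i=0}^{k-1}(m-i)$. The noncentral Stirling numbers of the second kind are, for integers $n, k \geq 0$ and real $\phi$, $$S(n,k,\phi) = \frac{1}{k!}\sum_{i=0}^{k} \binom{k}{i} (-1)^{k-i} (i+\phi)^n, \qquad 0^0 = 1.$$ The negative occupancy distribution $\text{NegOcc}(m,k,\theta)$, with occupancy parameter $k$ and space parameter $m$ satisfying $0<k\leq m\leq\infty$ and probability parameter $0<\theta\leq 1$, is the distribution on the integers $t \geq 0$ with probability mass function $$\text{NegOcc}(t|m,k,\theta) = \frac{\theta^{k+t}}{m^{k+t}} \cdot (m)_k \cdot S\left(k+t-1, k-1, m\cdot\frac{1-\theta}{\theta}\right);$$ for $m=\infty$ it is the limiting case, the negative binomial distribution with mass function $\binom{k+t-1}{t}\theta^k(1-\theta)^t$. $\text{Geom}(s|p) = (1-p)^s p$ for $s = 0,1,2,\ldots$ is the geometric mass function (with $0^0=1$).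
   Formalization: For m = ∞ and k ≥ 2 the weights are infinite with alternating signs, so the weighted sum is undefined; there the claim is read as: the weighted sums for finite m converge, as m → ∞, to the negative binomial mass function. *)

theory Defs
  imports "HOL-Probability.Probability" "HOL-Library.Extended_Nat"
begin

definition falling_fact :: "real \<Rightarrow> nat \<Rightarrow> real" where
  "falling_fact x k = (\<Prod>i<k. x - real i)"

definition nc_stirling2 :: "nat \<Rightarrow> nat \<Rightarrow> real \<Rightarrow> real" where
  "nc_stirling2 n k \<phi> =
     1 / fact k * (\<Sum>i=0..k. real (k choose i) * (-1) ^ (k - i) * (real i + \<phi>) ^ n)"

text \<open>
  Mass function at \<open>t\<close> of the negative occupancy distribution with space parameter \<open>m\<close>,
  occupancy parameter \<open>k\<close> and probability parameter \<open>\<theta>\<close>, meaningful for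
  \<open>0 < k \<le> m \<le> \<infinity>\<close> and \<open>0 < \<theta> \<le> 1\<close>; since \<open>k > 0\<close>, the natural-number subtractions
  below do not truncate.
\<close>
definition neg_occ :: "nat \<Rightarrow> enat \<Rightarrow> nat \<Rightarrow> real \<Rightarrow> real" where
  "neg_occ t m k \<theta> =
     (case m of
        enat M \<Rightarrow> \<theta> ^ (k + t) / real M ^ (k + t) * falling_fact (real M) k *
                   nc_stirling2 (k + t - 1) (k - 1) (real M * ((1 - \<theta>) / \<theta>))
      | \<infinity> \<Rightarrow> pmf (neg_binomial_pmf k \<theta>) t)"

lemma neg_occ_infinity:
  assumes "0 < \<theta>" "\<theta> \<le> 1"
  shows "neg_occ t \<infinity> k \<theta> = real ((k + t - 1) choose t) * \<theta> ^ k * (1 - \<theta>) ^ t"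
  using assms by (simp add: neg_occ_def pmf_neg_binomial add.commute)

definition geom_weight :: "nat \<Rightarrow> nat \<Rightarrow> nat \<Rightarrow> real" where
  "geom_weight M k i =
     (-1) ^ (k - i) *
     (falling_fact (real M) k / ((real M - real i + 1) * fact (i - 1) * fact (k - i)))"

end

theory Submission
  imports Defs
begin

text \<open>
  With \<open>\<phi> = M (1 - \<theta>) / \<theta>\<close>, the \<open>i\<close>-th geometric distribution has failure probability
  \<open>(i - 1 + \<phi>) \<theta> / M\<close>, so for finite \<open>M\<close> the identity is the explicit formula for
  \<open>S(k + t - 1, k - 1, \<phi>)\<close> term by term. For \<open>m = \<infinity>\<close> the triangular recurrence of the
  noncentral Stirling numbers passes to the limit of \<open>S(r + t, r, c x) / x ^ t\<close> as \<open>x \<rightarrow> \<infinity>\<close>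
  and becomes Pascal's rule for \<open>binomial (r + t) t * c ^ t\<close>.
\<close>

lemma nc_stirling2_0_right: "nc_stirling2 n 0 \<phi> = \<phi> ^ n"
  by (simp add: nc_stirling2_def)

text \<open>For exponent 0 the defining alternating sum is the binomial expansion of
  \<open>(1 + (-1)) ^ Suc k\<close>.\<close>

lemma nc_stirling2_0_Suc: "nc_stirling2 0 (Suc k) \<phi> = 0"
proof -
  have "(1 + (-1::real)) ^ Suc k = (\<Sum>i\<le>Suc k. of_nat (Suc k choose i) * 1 ^ i * (-1) ^ (Suc k - i))"
    by (rule binomial_ring)
  then show ?thesis
    by (simp add: nc_stirling2_def atLeast0AtMost del: sum.atMost_Suc)
qed

text \<open>The extra factor is split as \<open>real i + \<phi> = (real (Suc k) + \<phi>) - (real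
  (Suc k) - real i)\<close>; absorbing the second part into the binomial coefficient turns
  \<open>Suc k choose i\<close> into \<open>k choose i\<close>.\<close>

lemma nc_stirling2_Suc_Suc:
  "nc_stirling2 (Suc n) (Suc k) \<phi> =
     (real (Suc k) + \<phi>) * nc_stirling2 n (Suc k) \<phi> + nc_stirling2 n k \<phi>"
proof -
  define s where "s i = (-1::real) ^ (Suc k - i) * (real i + \<phi>) ^ n" for i
  have absorb: "real (Suc k choose i) * (real (Suc k) - real i) = real (Suc k) * real (k choose i)"
    if "i \<le> Suc k" for i
  proof (cases "i = Suc k")
    case False
    with that have "(Suc k - i) * (Suc k choose i) = Suc k * (k choose i)"
      using binomial_absorb_comp[of "Suc k" i] by simp
    then have "real (Suc k - i) * real (Suc k choose i) = real (Suc k) * real (k choose i)"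
      by (metis of_nat_mult)
    with that show ?thesis by (simp add: of_nat_diff mult.commute)
  qed simp
  have "(\<Sum>i=0..Suc k. real (Suc k choose i) * (-1) ^ (Suc k - i) * (real i + \<phi>) ^ Suc n)
      = (\<Sum>i=0..Suc k. (real (Suc k) + \<phi>) * (real (Suc k choose i) * s i)
                       - real (Suc k) * (real (k choose i) * s i))"
  proof (rule sum.cong[OF refl])
    fix i assume "i \<in> {0..Suc k}"
    then have "real (Suc k choose i) * (real (Suc k) - real i) * s i
                 = real (Suc k) * real (k choose i) * s i"
      using absorb by simp
    then show "real (Suc k choose i) * (-1) ^ (Suc k - i) * (real i + \<phi>) ^ Suc n =
        (real (Suc k) + \<phi>) * (real (Suc k choose i) * s i)
          - real (Suc k) * (real (k choose i) * s i)"
      unfolding power_Suc s_def by (simp only: algebra_simps)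
  qed
  also have "\<dots> = (real (Suc k) + \<phi>) * (\<Sum>i=0..Suc k. real (Suc k choose i) * s i)
                - real (Suc k) * (\<Sum>i=0..Suc k. real (k choose i) * s i)"
    by (simp only: sum_subtractf sum_distrib_left)
  \<comment> \<open>The term at \<open>i = Suc k\<close> vanishes because
    \<open>k choose Suc k = 0\<close>; elsewhere \<open>s i\<close> carries one sign more than the
    sum for \<open>k\<close>.\<close>
  also have "(\<Sum>i=0..Suc k. real (k choose i) * s i) =
      - (\<Sum>i=0..k. real (k choose i) * (-1) ^ (k - i) * (real i + \<phi>) ^ n)"
    by (simp add: s_def Suc_diff_le sum_negf[symmetric] mult.assoc)
  finally have "fact (Suc k) * nc_stirling2 (Suc n) (Suc k) \<phi> =
      (real (Suc k) + \<phi>) * (fact (Suc k) * nc_stirling2 n (Suc k) \<phi>)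
        + real (Suc k) * (fact k * nc_stirling2 n k \<phi>)"
    by (simp add: nc_stirling2_def s_def mult.assoc del: sum.atLeast0_atMost_Suc fact_Suc)
  also have "\<dots> = fact (Suc k) *
      ((real (Suc k) + \<phi>) * nc_stirling2 n (Suc k) \<phi> + nc_stirling2 n k \<phi>)"
    by (simp add: algebra_simps)
  finally show ?thesis by (simp del: fact_Suc)
qed

lemma nc_stirling2_eq_0: "n < k \<Longrightarrow> nc_stirling2 n k \<phi> = 0"
proof (induction n arbitrary: k)
  case 0
  then show ?case by (cases k) (simp_all add: nc_stirling2_0_Suc)
next
  case (Suc n)
  then show ?case by (cases k) (simp_all add: nc_stirling2_Suc_Suc)
qed

text \<open>In the recurrence at \<open>n = k\<close> the first summand lies above the diagonal and
  vanishes, so the value carries over from \<open>k\<close> to \<open>Suc k\<close>.\<close>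

lemma nc_stirling2_self: "nc_stirling2 k k \<phi> = 1"
  by (induction k) (simp_all add: nc_stirling2_0_right nc_stirling2_Suc_Suc nc_stirling2_eq_0)

lemma nc_stirling2_scaled_tendsto:
  "(\<lambda>M. nc_stirling2 (r + t) r (real M * c) / real M ^ t)
     \<longlonglongrightarrow> real ((r + t) choose t) * c ^ t"
\<comment> \<open>The recurrence lowers either \<open>r\<close> or \<open>t\<close> and keeps the
  other, so the induction runs on their sum.\<close>
proof (induction "r + t" arbitrary: r t rule: less_induct)
  case less
  consider "t = 0" | "r = 0" | r' t' where "r = Suc r'" "t = Suc t'"
    by (metis not0_implies_Suc)
  then show ?case
  proof cases
    case 1
    then show ?thesis by (simp add: nc_stirling2_self)
  next
    case 2
    \<comment> \<open>At \<open>M = 0\<close> and \<open>t > 0\<close> the quotient is 0 by the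
      convention for division by zero, so the equality holds only eventually.\<close>
    have "\<forall>\<^sub>F M in sequentially. (real M * c) ^ t / real M ^ t = c ^ t"
      using eventually_gt_at_top[of 0] by eventually_elim (simp add: power_mult_distrib)
    then have "(\<lambda>M. (real M * c) ^ t / real M ^ t) \<longlonglongrightarrow> c ^ t"
      by (rule tendsto_eventually)
    with 2 show ?thesis
      by (simp add: nc_stirling2_0_right)
  next
    case 3
    let ?S = "\<lambda>n k M. nc_stirling2 n k (real M * c)"
    have "(\<lambda>M. real r / real M + c) \<longlonglongrightarrow> 0 + c"
      by (intro tendsto_add tendsto_const tendsto_divide_0[OF tendsto_const]
          filterlim_at_top_imp_at_infinity filterlim_real_sequentially)
    moreover have "(\<lambda>M. ?S (r + t') r M / real M ^ t') \<longlonglongrightarrow> real ((r + t') choose t') * c ^ t'"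
      and "(\<lambda>M. ?S (r' + t) r' M / real M ^ t) \<longlonglongrightarrow> real ((r' + t) choose t) * c ^ t"
      by (intro less; use 3 in simp)+
    \<comment> \<open>This is the recurrence divided by \<open>real M ^ t\<close>: one factor
      \<open>real M\<close> goes to the coefficient \<open>real r + real M * c\<close>, the other
      \<open>t'\<close> to the Stirling number.\<close>
    ultimately have lim: "(\<lambda>M. (real r / real M + c) * (?S (r + t') r M / real M ^ t')
          + ?S (r' + t) r' M / real M ^ t)
        \<longlonglongrightarrow> (0 + c) * (real ((r + t') choose t') * c ^ t') + real ((r' + t) choose t) * c ^ t"
      by (rule tendsto_add[OF tendsto_mult])
    \<comment> \<open>Pascal's rule applies since \<open>r + t'\<close> and \<open>r' + t\<close>
      are both \<open>r + t - 1\<close>.\<close>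
    have "(0 + c) * (real ((r + t') choose t') * c ^ t') + real ((r' + t) choose t) * c ^ t
        = real ((r + t) choose t) * c ^ t"
      using 3 by (simp add: algebra_simps)
    moreover have "\<forall>\<^sub>F M in sequentially. (real r / real M + c) * (?S (r + t') r M / real M ^ t')
          + ?S (r' + t) r' M / real M ^ t = ?S (r + t) r M / real M ^ t"
      using eventually_gt_at_top[of 0]
    proof eventually_elim
      case (elim M)
      have "?S (r + t) r M = (real r + real M * c) * ?S (r + t') r M + ?S (r' + t) r' M"
        using 3 nc_stirling2_Suc_Suc[of "r' + t" r'] by simp
      with 3 elim show ?case by (simp add: field_simps)
    qed
    ultimately show ?thesis
      using Lim_transform_eventually[OF lim] by simp
  qed
qed

text \<open>Each of the fixed number \<open>k\<close> of factors
  \<open>(real M - real i) / real M\<close> tends to 1.\<close>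

lemma falling_fact_over_power_tendsto:
  "(\<lambda>M. falling_fact (real M) k / real M ^ k) \<longlonglongrightarrow> 1"
proof -
  have "(\<lambda>M. \<Prod>i<k. 1 - real i / real M) \<longlonglongrightarrow> (\<Prod>i<k. 1 - 0)"
    by (intro tendsto_prod tendsto_diff tendsto_const tendsto_divide_0[OF tendsto_const]
        filterlim_at_top_imp_at_infinity filterlim_real_sequentially)
  moreover have "\<forall>\<^sub>F M in sequentially.
      (\<Prod>i<k. 1 - real i / real M) = falling_fact (real M) k / real M ^ k"
    using eventually_gt_at_top[of 0]
  proof eventually_elim
    case (elim M)
    then have "(\<Prod>i<k. 1 - real i / real M) = (\<Prod>i<k. (real M - real i) / real M)"
      by (intro prod.cong) (simp_all add: field_simps)
    then show ?case by (simp add: falling_fact_def prod_dividef)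
  qed
  ultimately show ?thesis
    by (auto intro: Lim_transform_eventually)
qed

text \<open>The denominator \<open>real M ^ (k + t)\<close> is shared out: \<open>real M ^ k\<close>
  normalises the falling factorial and \<open>real M ^ t\<close> the Stirling number.\<close>

lemma neg_occ_tendsto:
  assumes "0 < k" "0 < \<theta>" "\<theta> \<le> 1"
  shows "(\<lambda>M. neg_occ t (enat M) k \<theta>) \<longlonglongrightarrow> neg_occ t \<infinity> k \<theta>"
proof -
  have k: "k + t - 1 = k - 1 + t" using assms(1) by simp
  let ?S = "\<lambda>M. nc_stirling2 (k - 1 + t) (k - 1) (real M * ((1 - \<theta>) / \<theta>))"
  have "(\<lambda>M. \<theta> ^ (k + t) * (falling_fact (real M) k / real M ^ k) * (?S M / real M ^ t))
      \<longlonglongrightarrow> \<theta> ^ (k + t) * 1 * (real ((k - 1 + t) choose t) * ((1 - \<theta>) / \<theta>) ^ t)"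
    by (intro tendsto_mult tendsto_const falling_fact_over_power_tendsto
        nc_stirling2_scaled_tendsto)
  moreover have "neg_occ t (enat M) k \<theta> =
      \<theta> ^ (k + t) * (falling_fact (real M) k / real M ^ k) * (?S M / real M ^ t)" for M
    unfolding neg_occ_def k power_add by simp
  moreover have "neg_occ t \<infinity> k \<theta> =
      \<theta> ^ (k + t) * 1 * (real ((k - 1 + t) choose t) * ((1 - \<theta>) / \<theta>) ^ t)"
    unfolding neg_occ_infinity[OF assms(2,3)] k power_add power_divide using assms(2) by simp
  ultimately show ?thesis by simp
qed

lemma neg_occ_eq_sum_geometric:
  assumes "0 < k" "k \<le> M" "0 < \<theta>" "\<theta> \<le> 1"
  shows "neg_occ t (enat M) k \<theta> =
    (\<Sum>i=1..k. geom_weight M k i *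
       pmf (geometric_pmf (\<theta> * ((real M - real i + 1) / real M))) (t + k - 1))"
proof -
  obtain r where k: "k = Suc r"
    using assms(1) by (cases k) auto
  define \<phi> where "\<phi> = real M * ((1 - \<theta>) / \<theta>)"
  have M: "0 < real M" using assms by simp
  have "(\<Sum>i=1..k. geom_weight M k i *
          pmf (geometric_pmf (\<theta> * ((real M - real i + 1) / real M))) (t + k - 1))
      = (\<Sum>i=0..r. geom_weight M k (Suc i) *
          pmf (geometric_pmf (\<theta> * ((real M - real i) / real M))) (r + t))"
    by (simp add: k sum.atLeast_Suc_atMost_Suc_shift add.commute del: sum.cl_ivl_Suc)
  also have "\<dots> = (\<Sum>i=0..r. \<theta> ^ (k + t) / real M ^ (k + t) * falling_fact (real M) k *
      (1 / fact r * (real (r choose i) * (-1) ^ (r - i) * (real i + \<phi>) ^ (r + t))))"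
  proof (rule sum.cong[OF refl])
    fix i assume "i \<in> {0..r}"
    \<comment> \<open>Since \<open>i < k \<le> M\<close>, the success probability is positive and
      the denominator of the weight is nonzero.\<close>
    then have i: "i \<le> r" and Mi: "0 < real M - real i" using assms k by auto
    define p where "p = \<theta> * ((real M - real i) / real M)"
    have "0 < p" using assms M Mi by (simp add: p_def)
    moreover have "p \<le> 1"
      using assms M Mi unfolding p_def by (intro mult_le_one) simp_all
    ultimately have "pmf (geometric_pmf p) (r + t) = (1 - p) ^ (r + t) * p"
      by simp
    also have "1 - p = \<theta> / real M * (real i + \<phi>)"
      using M assms by (simp add: p_def \<phi>_def field_simps)
    \<comment> \<open>The \<open>r + t\<close> failures give that many factors
      \<open>\<theta> / real M\<close>; the success probability supplies one more, hence the
      exponent \<open>k + t\<close>, and leaves \<open>real M - real i\<close>.\<close>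
    finally have geom: "pmf (geometric_pmf p) (r + t) =
        (\<theta> / real M) ^ (k + t) * (real i + \<phi>) ^ (r + t) * (real M - real i)"
      unfolding power_mult_distrib by (simp add: p_def k)
    \<comment> \<open>The left-over \<open>real M - real i\<close> cancels against the weight, and
      the two factorials combine to \<open>(r choose i) / fact r\<close>.\<close>
    have weight: "geom_weight M k (Suc i) * (real M - real i) =
        falling_fact (real M) k * (1 / fact r * (real (r choose i) * (-1) ^ (r - i)))"
      using Mi i by (simp add: geom_weight_def k binomial_fact field_simps)
    have "geom_weight M k (Suc i) * pmf (geometric_pmf p) (r + t) =
        (\<theta> / real M) ^ (k + t) * (real i + \<phi>) ^ (r + t)
          * (geom_weight M k (Suc i) * (real M - real i))"
      unfolding geom by (simp only: mult_ac)
    then show "geom_weight M k (Suc i) *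
          pmf (geometric_pmf (\<theta> * ((real M - real i) / real M))) (r + t) =
        \<theta> ^ (k + t) / real M ^ (k + t) * falling_fact (real M) k *
          (1 / fact r * (real (r choose i) * (-1) ^ (r - i) * (real i + \<phi>) ^ (r + t)))"
      unfolding weight p_def[symmetric] power_divide by (simp only: mult_ac)
  qed
  also have "\<dots> = neg_occ t (enat M) k \<theta>"
    by (simp add: neg_occ_def nc_stirling2_def k \<phi>_def sum_distrib_left)
  finally show ?thesis by simp
qed

text \<open>For \<open>m = \<infinity>\<close> the sum is read as a limit: all the geometric
  parameters tend to \<open>\<theta>\<close>, while for \<open>k \<ge> 2\<close> the individual
  weights are unbounded in \<open>M\<close>.\<close>

theorem theorem2:
  fixes m :: enat and k t :: nat and \<theta> :: real
  assumes "0 < k" and "enat k \<le> m" and "0 < \<theta>" and "\<theta> \<le> 1"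
  shows "case m of
           enat M \<Rightarrow>
             neg_occ t (enat M) k \<theta> =
               (\<Sum>i=1..k. geom_weight M k i *
                  pmf (geometric_pmf (\<theta> * ((real M - real i + 1) / real M))) (t + k - 1))
         | \<infinity> \<Rightarrow>
             (\<lambda>M. \<Sum>i=1..k. geom_weight M k i *
                  pmf (geometric_pmf (\<theta> * ((real M - real i + 1) / real M))) (t + k - 1))
               \<longlonglongrightarrow> neg_occ t \<infinity> k \<theta>"
proof (cases m)
  case (enat M)
  then show ?thesis
    using assms neg_occ_eq_sum_geometric by simp
next
  case infinity
  \<comment> \<open>The finite case covers only \<open>M \<ge> k\<close>, which suffices for the
    limit.\<close>
  have "\<forall>\<^sub>F M in sequentially. neg_occ t (enat M) k \<theta> =
      (\<Sum>i=1..k. geom_weight M k i *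
         pmf (geometric_pmf (\<theta> * ((real M - real i + 1) / real M))) (t + k - 1))"
    using eventually_ge_at_top[of k]
    by eventually_elim (use assms neg_occ_eq_sum_geometric in blast)
  from Lim_transform_eventually[OF neg_occ_tendsto[OF assms(1,3,4)] this] infinity show ?thesis
    by simp
qed

end
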